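(* Let $j=\min\{i\in[t] : m_i=m_t\}$ and let $d=\sum_{i=1}^{j-1}n_i+\delta+1$ for some $0\leq\delta\leq n_j-1$. Let $h=\max\{i\in[t] : n_i>m_t\}$ and assume that $h\in[t]$ (that is, the set $\{i\in[t] : n_i>m_t\}$ is nonempty) and that $m_h\geq m_t\left(\sum_{i=j}^t n_i-\delta\right)$. If $q>t-h$, then there exist MSRD codes $\mathcal{C}_n\subseteq\cdots\subseteq\mathcal{C}_{d+1}\subseteq\mathcal{C}_d\subseteq\mathbb{M}$ with $d(\mathcal{C}_i)=i$ for $d\leq i\leq n=n_1+\cdots+n_t$.
   Context: Write $[r]=\{1,\ldots,r\}$. Let $q$ be a prime power and let $t,n_1,\ldots,n_t,m_1,\ldots,m_t$ be positive integers with $m_1\geq\cdots\geq m_t$ and $m_i\geq n_i$ for $i\in[t]$. Let $\mathbb{M}=\mathbb{F}_q^{m_1\times n_1}\times\cdots\times\mathbb{F}_q^{m_t\times n_t}$ and $n=n_1+\cdots+n_t$. For $C=(C_1,\ldots,C_t)\in\mathbb{M}$ let $\mathrm{srk}(C)=\sum_{i=1}^t\mathrm{rk}(C_i)$. A code is an $\mathbb{F}_q$-linear subspace $\mathcal{C}\subseteq\mathbb{M}$; the minimum distance of $\mathcal{C}\neq 0$ is $d(\mathcal{C})=\min\{\mathrm{srk}(C) : C\in\mathcal{C}\setminus 0\}$. A code $\mathcal{C}\subseteq\mathbb{M}$ is maximum sum-rank distance (MSRD) if there exist $l\in[t]$ and $0\leq\epsilon\leq n_l-1$ such that $d(\mathcal{C})=\sum_{i=1}^{l-1}n_i+\epsilon+1$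 and $\dim_{\mathbb{F}_q}(\mathcal{C})=\sum_{i=l}^t m_in_i-\epsilon m_l$. *)

theory Defs
  imports "Jordan_Normal_Form.DL_Rank" "HOL-Library.Cardinality"
begin

text \<open>The ambient space: tuples of matrices over the finite field \<open>'a\<close>, the \<open>i\<close>-th of size
  \<open>m i \<times> n i\<close>, as extensional functions on \<open>{1..t}\<close>. The record fields \<open>mult\<close> and \<open>one\<close> play no
  role in a vector space. Values of \<open>m\<close> and \<open>n\<close> outside \<open>{1..t}\<close> are irrelevant.\<close>

definition sumrank_space ::
  "'a::{field,finite} itself \<Rightarrow> nat \<Rightarrow> (nat \<Rightarrow> nat) \<Rightarrow> (nat \<Rightarrow> nat) \<Rightarrow> ('a, nat \<Rightarrow> 'a mat) module"
  where
  "sumrank_space _ t m n =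
    \<lparr> carrier = (\<Pi>\<^sub>E i\<in>{1..t}. carrier_mat (m i) (n i)),
      mult = undefined,
      one = undefined,
      zero = (\<lambda>i\<in>{1..t}. 0\<^sub>m (m i) (n i)),
      add = (\<lambda>A B. \<lambda>i\<in>{1..t}. A i + B i),
      smult = (\<lambda>c A. \<lambda>i\<in>{1..t}. c \<cdot>\<^sub>m A i) \<rparr>"

lemma sumrank_space_simps:
  "carrier (sumrank_space TYPE('a::{field,finite}) t m n) = (\<Pi>\<^sub>E i\<in>{1..t}. carrier_mat (m i) (n i))"
  "zero (sumrank_space TYPE('a) t m n) = (\<lambda>i\<in>{1..t}. 0\<^sub>m (m i) (n i))"
  "add (sumrank_space TYPE('a) t m n) = (\<lambda>A B. \<lambda>i\<in>{1..t}. A i + B i)"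
  "smult (sumrank_space TYPE('a) t m n) = (\<lambda>c A. \<lambda>i\<in>{1..t}. c \<cdot>\<^sub>m A i)"
  by (simp_all add: sumrank_space_def)

lemma vectorspace_sumrank_space:
  "vectorspace class_ring (sumrank_space TYPE('a::{field,finite}) t m n)"
proof -
  let ?V = "sumrank_space TYPE('a) t m n"
  have mat: "A i \<in> carrier_mat (m i) (n i)" if "A \<in> carrier ?V" "i \<in> {1..t}" for A i
    using that by (auto simp: sumrank_space_simps)
  have eqI: "A = B" if "A \<in> carrier ?V" "B \<in> carrier ?V" "\<And>i. i \<in> {1..t} \<Longrightarrow> A i = B i" for A B
    using that unfolding sumrank_space_simps by (rule PiE_ext)
  have VI: "(\<lambda>i\<in>{1..t}. F i) \<in> carrier ?V" if "\<And>i. i \<in> {1..t} \<Longrightarrow> F i \<in> carrier_mat (m i) (n i)" for F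
    using that by (auto simp: sumrank_space_simps)
  have closed [simp]: "A \<oplus>\<^bsub>?V\<^esub> B \<in> carrier ?V" if "A \<in> carrier ?V" "B \<in> carrier ?V" for A B
    unfolding sumrank_space_simps(3) using that by (intro VI add_carrier_mat mat)
  have smult_closed [simp]: "c \<odot>\<^bsub>?V\<^esub> A \<in> carrier ?V" if "A \<in> carrier ?V" for A c
    unfolding sumrank_space_simps(4) using that by (intro VI smult_carrier_mat mat)
  have zero [simp]: "\<zero>\<^bsub>?V\<^esub> \<in> carrier ?V"
    by (auto simp: sumrank_space_simps)
  have add_ap: "(A \<oplus>\<^bsub>?V\<^esub> B) i = A i + B i" and smult_ap: "(c \<odot>\<^bsub>?V\<^esub> A) i = c \<cdot>\<^sub>m A i"
    and zero_ap: "\<zero>\<^bsub>?V\<^esub> i = 0\<^sub>m (m i) (n i)" if "i \<in> {1..t}" for A B c i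
    using that by (simp_all add: sumrank_space_simps)
  interpret abelian_group ?V
  proof (rule abelian_groupI)
    show "\<exists>B\<in>carrier ?V. B \<oplus>\<^bsub>?V\<^esub> A = \<zero>\<^bsub>?V\<^esub>" if A: "A \<in> carrier ?V" for A
    proof
      let ?B = "\<lambda>i\<in>{1..t}. - A i"
      show B: "?B \<in> carrier ?V"
        using A by (intro VI uminus_carrier_mat mat)
      show "?B \<oplus>\<^bsub>?V\<^esub> A = \<zero>\<^bsub>?V\<^esub>"
      proof (rule eqI)
        fix i assume i: "i \<in> {1..t}"
        show "(?B \<oplus>\<^bsub>?V\<^esub> A) i = \<zero>\<^bsub>?V\<^esub> i"
          using mat[OF A i] i unfolding add_ap[OF i] zero_ap[OF i]
          by (simp add: uminus_l_inv_mat)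
      qed (use A B in auto)
    qed
    show "A \<oplus>\<^bsub>?V\<^esub> B \<oplus>\<^bsub>?V\<^esub> C = A \<oplus>\<^bsub>?V\<^esub> (B \<oplus>\<^bsub>?V\<^esub> C)"
      if "A \<in> carrier ?V" "B \<in> carrier ?V" "C \<in> carrier ?V" for A B C
      by (rule eqI) (use that in \<open>simp_all add: add_ap assoc_add_mat[OF mat mat mat] del: assoc_add_mat\<close>)
    show "A \<oplus>\<^bsub>?V\<^esub> B = B \<oplus>\<^bsub>?V\<^esub> A" if "A \<in> carrier ?V" "B \<in> carrier ?V" for A B
      by (rule eqI) (use that in \<open>simp_all add: add_ap comm_add_mat[OF mat mat]\<close>)
    show "\<zero>\<^bsub>?V\<^esub> \<oplus>\<^bsub>?V\<^esub> A = A" if "A \<in> carrier ?V" for A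
      by (rule eqI) (use that in \<open>simp_all add: add_ap zero_ap left_add_zero_mat[OF mat]\<close>)
  qed auto
  show ?thesis
    unfolding class_field_def
  proof unfold_locales
    show "c \<odot>\<^bsub>?V\<^esub> A \<in> carrier ?V" if "c \<in> carrier class_ring" "A \<in> carrier ?V" for c A
      using that by auto
    show "(a \<oplus>\<^bsub>class_ring\<^esub> b) \<odot>\<^bsub>?V\<^esub> A = a \<odot>\<^bsub>?V\<^esub> A \<oplus>\<^bsub>?V\<^esub> b \<odot>\<^bsub>?V\<^esub> A"
      if "A \<in> carrier ?V" for a b A
      by (rule eqI) (use that in \<open>simp_all add: add_ap smult_ap add_smult_distrib_right_mat[OF mat]\<close>)
    show "a \<odot>\<^bsub>?V\<^esub> (A \<oplus>\<^bsub>?V\<^esub> B) = a \<odot>\<^bsub>?V\<^esub> A \<oplus>\<^bsub>?V\<^esub> a \<odot>\<^bsub>?V\<^esub> B"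
      if "A \<in> carrier ?V" "B \<in> carrier ?V" for a A B
      by (rule eqI) (use that in \<open>simp_all add: add_ap smult_ap add_smult_distrib_left_mat[OF mat mat]\<close>)
    show "(a \<otimes>\<^bsub>class_ring\<^esub> b) \<odot>\<^bsub>?V\<^esub> A = a \<odot>\<^bsub>?V\<^esub> (b \<odot>\<^bsub>?V\<^esub> A)" if "A \<in> carrier ?V" for a b A
      by (rule eqI) (use that in \<open>auto simp: smult_ap\<close>)
    show "\<one>\<^bsub>class_ring\<^esub> \<odot>\<^bsub>?V\<^esub> A = A" if "A \<in> carrier ?V" for A
      by (rule eqI) (use that in \<open>auto simp: smult_ap\<close>)
  qed
qed

text \<open>The dimension argument of \<^const>\<open>vec_space.rank\<close> is the number of rows.\<close>

definition srk :: "nat \<Rightarrow> (nat \<Rightarrow> nat) \<Rightarrow> (nat \<Rightarrow> 'a::{field,finite} mat) \<Rightarrow> nat"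
  where "srk t m A = (\<Sum>i=1..t. vec_space.rank (m i) (A i))"

definition code :: "nat \<Rightarrow> (nat \<Rightarrow> nat) \<Rightarrow> (nat \<Rightarrow> nat) \<Rightarrow> (nat \<Rightarrow> 'a::{field,finite} mat) set \<Rightarrow> bool"
  where "code t m n C \<longleftrightarrow> subspace class_ring C (sumrank_space TYPE('a) t m n)"

definition code_dim :: "nat \<Rightarrow> (nat \<Rightarrow> nat) \<Rightarrow> (nat \<Rightarrow> nat) \<Rightarrow> (nat \<Rightarrow> 'a::{field,finite} mat) set \<Rightarrow> nat"
  where "code_dim t m n C = vectorspace.dim class_ring (sumrank_space TYPE('a) t m n\<lparr>carrier := C\<rparr>)"

text \<open>Meaningful only for nonzero codes; the set over which \<open>Min\<close> is taken is then finite and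
  nonempty.\<close>

definition min_distance :: "nat \<Rightarrow> (nat \<Rightarrow> nat) \<Rightarrow> (nat \<Rightarrow> nat) \<Rightarrow> (nat \<Rightarrow> 'a::{field,finite} mat) set \<Rightarrow> nat"
  where "min_distance t m n C = Min (srk t m ` (C - {\<zero>\<^bsub>sumrank_space TYPE('a) t m n\<^esub>}))"

text \<open>For \<open>m i, n i > 0\<close> the subtractions below do not truncate, and the dimension
  is positive, so an MSRD code is nonzero and its minimum distance is meaningful.\<close>

definition msrd :: "nat \<Rightarrow> (nat \<Rightarrow> nat) \<Rightarrow> (nat \<Rightarrow> nat) \<Rightarrow> (nat \<Rightarrow> 'a::{field,finite} mat) set \<Rightarrow> bool"
  where "msrd t m n C \<longleftrightarrow> code t m n C \<and>
    (\<exists>l\<in>{1..t}. \<exists>\<epsilon>\<le>n l - 1.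
       min_distance t m n C = (\<Sum>i=1..<l. n i) + \<epsilon> + 1 \<and>
       code_dim t m n C = (\<Sum>i=l..t. m i * n i) - \<epsilon> * m l)"

end

theory Submission
  imports Defs "HOL-Algebra.Algebraic_Closure_Type"
begin

text \<open>Let \<open>M = m t\<close> and \<open>s = n - i + 1\<close>; the code of distance \<open>i\<close> must have dimension \<open>M * s\<close>. On the
  blocks up to \<open>h\<close>, the rows are so long that the whole message fits into one element of the field of
  order \<open>q ^ m i\<close>, and multiplication by it gives a matrix of full rank \<open>n i\<close>. On the fewer than \<open>q\<close>
  blocks after \<open>h\<close> one uses a linearized Reed-Solomon code: a linearized polynomial \<open>F\<close> of \<open>q\<close>-degree
  below \<open>s\<close> acts on each space \<open>{x. x ^ (q ^ M) = a * x}\<close> inside the algebraic closure, one nonzero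
  scalar \<open>a\<close> per block. These are eigenspaces of the iterated Frobenius for distinct eigenvalues,
  hence independent, so the rank defects of the blocks add up to at most the dimension \<open>s - 1\<close> of the
  root space of \<open>F\<close>. Dimensions are obtained by counting, and pigeonhole shows that the distance is
  not larger. Polynomials of smaller \<open>q\<close>-degree give the nested codes.\<close>

section \<open>Eigenspaces of the Frobenius in the algebraic closure\<close>

lemma one_less_card_field: "1 < CARD('a::{field,finite})"
proof -
  have "card {0, 1 :: 'a} \<le> CARD('a)"
    by (rule card_mono) auto
  then show ?thesis
    by simp
qed

text \<open>Translation by 1 permutes the field, so the sum of all elements does not change when q
  copies of 1 are added to it.\<close>

lemma of_nat_card_field: "of_nat CARD('a) = (0 :: 'a::{field,finite})"
proof -
  have "(\<Sum>a\<in>(UNIV :: 'a set). a) = (\<Sum>a\<in>(UNIV :: 'a set). a + 1)"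
    by (rule sum.reindex_bij_witness[of _ "\<lambda>a. a + 1" "\<lambda>a. a - 1"]) auto
  then show ?thesis
    by (simp add: sum.distrib)
qed

text \<open>Multiplication by a nonzero \<open>a\<close> permutes the nonzero elements; comparing
  their products gives \<open>a\<close> to the power q - 1 equal to 1.\<close>

lemma field_power_card:
  fixes a :: "'a::{field,finite}"
  shows "a ^ CARD('a) = a"
proof (cases "a = 0")
  case False
  have "a ^ CARD('a) * (\<Prod>b\<in>UNIV - {0}. b) = a * (a ^ card (UNIV - {0 :: 'a}) * (\<Prod>b\<in>UNIV - {0}. b))"
    using one_less_card_field[where 'a = 'a] by (simp add: power_eq_if)
  also have "a ^ card (UNIV - {0 :: 'a}) * (\<Prod>b\<in>UNIV - {0}. b) = (\<Prod>b\<in>UNIV - {0}. a * b)"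
    by (simp add: prod.distrib)
  also have "\<dots> = (\<Prod>b\<in>UNIV - {0}. b)"
    by (rule prod.reindex_bij_witness[of _ "\<lambda>b. b / a" "\<lambda>b. a * b"]) (use False in auto)
  finally show ?thesis
    by simp
qed (use one_less_card_field[where 'a = 'a] in auto)

lemma to_ac_power_card:
  fixes a :: "'a::{field,finite}"
  shows "to_ac a ^ (CARD('a) ^ N) = to_ac a"
proof (induction N)
  case (Suc N)
  have "to_ac a ^ (CARD('a) ^ Suc N) = to_ac (a ^ CARD('a)) ^ (CARD('a) ^ N)"
    by (simp add: power_mult)
  then show ?case
    by (simp add: field_power_card Suc)
qed auto

text \<open>Both sides are monic polynomials of degree q in \<open>x\<close> that vanish on the q
  elements of the base field.\<close>

lemma power_card_minus_self:
  fixes x :: "'a::{field,finite} alg_closure"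
  shows "x ^ CARD('a) - x = (\<Prod>a\<in>UNIV. x - to_ac (a :: 'a))"
proof -
  let ?q = "CARD('a)"
  let ?P = "Polynomial.monom 1 ?q - Polynomial.monom 1 1 :: 'a alg_closure poly"
  let ?Q = "\<Prod>a\<in>UNIV. [:- to_ac (a :: 'a), 1:]"
  have q: "1 < ?q"
    by (rule one_less_card_field)
  have deg: "Polynomial.degree ?Q = ?q"
    by (subst degree_prod_eq_sum_degree) auto
  have "?P = ?Q"
  proof (rule poly_eqI_degree_lead_coeff[where A = "range (to_ac :: 'a \<Rightarrow> _)" and n = ?q])
    have "Polynomial.lead_coeff ?Q = 1"
      by (simp add: lead_coeff_prod)
    then show "poly.coeff ?P ?q = poly.coeff ?Q ?q"
      using q deg by simp
    show "card (range (to_ac :: 'a \<Rightarrow> _)) \<ge> ?q"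
      by (simp add: card_image inj_to_ac)
    show "Polynomial.degree ?P \<le> ?q"
      using q by (intro degree_diff_le) (auto simp: degree_monom_eq)
    show "Polynomial.degree ?Q \<le> ?q"
      using deg by simp
    show "poly ?P z = poly ?Q z" if z: "z \<in> range (to_ac :: 'a \<Rightarrow> _)" for z
    proof -
      obtain a :: 'a where a: "z = to_ac a"
        using z by auto
      have "poly ?Q z = (\<Prod>b\<in>UNIV. z - to_ac (b :: 'a))"
        by (simp add: poly_prod)
      also have "\<dots> = 0"
        using a by (intro prod_zero) auto
      finally show ?thesis
        using to_ac_power_card[of a 1] a by (simp add: poly_monom)
    qed
  qed
  then have "poly ?P x = poly ?Q x"
    by simp
  then show ?thesis
    by (simp add: poly_monom poly_prod)
qed

text \<open>Proved without the characteristic: for fixed \<open>y\<close>, after subtracting x + y,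
  both sides are monic of degree q in \<open>x\<close>. At each base field element both take the
  value y^q - y, because the product formula for x^q - x is invariant under translation by that
  element.\<close>

lemma power_card_add:
  fixes x y :: "'a::{field,finite} alg_closure"
  shows "(x + y) ^ CARD('a) = x ^ CARD('a) + y ^ CARD('a)"
proof -
  let ?q = "CARD('a)"
  let ?P = "[:y, 1:] ^ ?q - [:y, 1:] :: 'a alg_closure poly"
  let ?Q = "Polynomial.monom 1 ?q - Polynomial.monom 1 1 + [:y ^ ?q - y:] :: 'a alg_closure poly"
  have q: "1 < ?q"
    by (rule one_less_card_field)
  have "?P = ?Q"
  proof (rule poly_eqI_degree_lead_coeff[where A = "range (to_ac :: 'a \<Rightarrow> _)" and n = ?q])
    have deg: "Polynomial.degree ([:y, 1:] ^ ?q) = ?q"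
      by (simp add: degree_power_eq)
    have "poly.coeff ([:y, 1:] ^ ?q) ?q = 1"
      using deg lead_coeff_power[of "[:y, 1:]" ?q] by simp
    then show "poly.coeff ?P ?q = poly.coeff ?Q ?q"
      using q by (simp add: coeff_eq_0)
    show "card (range (to_ac :: 'a \<Rightarrow> _)) \<ge> ?q"
      by (simp add: card_image inj_to_ac)
    show "Polynomial.degree ?P \<le> ?q"
      using q deg by (intro degree_diff_le) auto
    show "Polynomial.degree ?Q \<le> ?q"
      using q by (intro degree_diff_le degree_add_le) (auto simp: degree_monom_eq)
    show "poly ?P z = poly ?Q z" if z: "z \<in> range (to_ac :: 'a \<Rightarrow> _)" for z
    proof -
      obtain a :: 'a where a: "z = to_ac a"
        using z by auto
      have "poly ?P z = (\<Prod>b\<in>UNIV. y + z - to_ac (b :: 'a))"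
        by (simp add: power_card_minus_self)
      also have "\<dots> = (\<Prod>b\<in>UNIV. y - to_ac (b :: 'a))"
        by (rule prod.reindex_bij_witness[of _ "\<lambda>b. b + a" "\<lambda>b. b - a"]) (auto simp: a)
      also have "\<dots> = y ^ ?q - y"
        by (simp add: power_card_minus_self)
      also have "\<dots> = poly ?Q z"
        using to_ac_power_card[of a 1] a by (simp add: poly_monom)
      finally show ?thesis .
    qed
  qed
  then have "poly ?P x = poly ?Q x"
    by simp
  then show ?thesis
    by (simp add: poly_monom algebra_simps)
qed

lemma power_card_power_add:
  fixes x y :: "'a::{field,finite} alg_closure"
  shows "(x + y) ^ (CARD('a) ^ N) = x ^ (CARD('a) ^ N) + y ^ (CARD('a) ^ N)"
  by (induction N arbitrary: x y) (simp_all add: power_mult power_card_add)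

lemma power_card_power_sum:
  fixes x :: "'i \<Rightarrow> 'a::{field,finite} alg_closure"
  shows "(\<Sum>i\<in>I. x i) ^ (CARD('a) ^ N) = (\<Sum>i\<in>I. x i ^ (CARD('a) ^ N))"
  by (induction I rule: infinite_finite_induct)
    (use zero_less_card_finite[where 'a = 'a] in \<open>simp_all add: power_card_power_add power_0_left\<close>)

text \<open>For N > 0, \<open>frob_eigenspace N 1\<close> is the field of order q^N, and for nonzero
  \<open>a\<close> the eigenspace is a one-dimensional vector space over that field.\<close>

definition frob_eigenspace :: "nat \<Rightarrow> 'a::{field,finite} \<Rightarrow> 'a alg_closure set" where
  "frob_eigenspace N a = {x. x ^ (CARD('a) ^ N) = to_ac a * x}"

lemma frob_eigenspace_scale:
  "x \<in> frob_eigenspace N a \<Longrightarrow> to_ac c * x \<in> frob_eigenspace N a"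
  by (simp add: frob_eigenspace_def power_mult_distrib to_ac_power_card)

lemma frob_eigenspace_add:
  "x \<in> frob_eigenspace N a \<Longrightarrow> y \<in> frob_eigenspace N a \<Longrightarrow> x + y \<in> frob_eigenspace N a"
  by (simp add: frob_eigenspace_def power_card_power_add algebra_simps)

lemma frob_eigenspace_zero: "0 \<in> frob_eigenspace N (a :: 'a::{field,finite})"
  using zero_less_card_finite[where 'a = 'a] by (simp add: frob_eigenspace_def power_0_left)

lemma frob_eigenspace_sum:
  "(\<And>i. i \<in> I \<Longrightarrow> x i \<in> frob_eigenspace N a) \<Longrightarrow> (\<Sum>i\<in>I. x i) \<in> frob_eigenspace N a"
  by (induction I rule: infinite_finite_induct)
    (auto intro: frob_eigenspace_add frob_eigenspace_zero)

text \<open>With one of the eigenvalues equal to 1, this says that every eigenspace is stable under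
  multiplication by the field of order q^N.\<close>

lemma frob_eigenspace_mult:
  "x \<in> frob_eigenspace N a \<Longrightarrow> y \<in> frob_eigenspace N b \<Longrightarrow> x * y \<in> frob_eigenspace N (a * b)"
  by (simp add: frob_eigenspace_def power_mult_distrib)

lemma frob_eigenspace_power:
  fixes a :: "'a::{field,finite}"
  assumes "x \<in> frob_eigenspace N a"
  shows "x ^ (CARD('a) ^ k) \<in> frob_eigenspace N a"
proof -
  have "(x ^ (CARD('a) ^ k)) ^ (CARD('a) ^ N) = (x ^ (CARD('a) ^ N)) ^ (CARD('a) ^ k)"
    by (simp add: mult.commute flip: power_mult)
  then show ?thesis
    using assms by (simp add: frob_eigenspace_def power_mult_distrib to_ac_power_card)
qed

text \<open>The eigenspace is the root set of X^(q^N) - aX. Since q vanishes in the field, the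
  derivative is the nonzero constant -a, so the polynomial splits into distinct linear factors and
  has as many roots as its degree.\<close>

lemma card_frob_eigenspace:
  fixes a :: "'a::{field,finite}"
  assumes a: "a \<noteq> 0" and N: "0 < N"
  shows "finite (frob_eigenspace N a)" "card (frob_eigenspace N a) = CARD('a) ^ N"
proof -
  let ?Q = "CARD('a) ^ N"
  define p where "p = Polynomial.monom 1 ?Q - Polynomial.monom (to_ac a) 1"
  have Q: "1 < ?Q"
    using N one_less_card_field[where 'a = 'a] by (intro one_less_power) auto
  have deg: "Polynomial.degree p = ?Q"
    using Q by (intro antisym) (auto simp: p_def degree_monom_eq intro!: degree_diff_le le_degree
        order.trans[OF degree_monom_le])
  then have p0: "p \<noteq> 0"
    using Q by auto
  have roots: "{x. poly p x = 0} = frob_eigenspace N a"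
    by (auto simp: p_def poly_monom frob_eigenspace_def)
  have "of_nat CARD('a) = (0 :: 'a alg_closure)"
    by (simp flip: to_ac_of_nat add: of_nat_card_field)
  then have pd: "pderiv p = [:- to_ac a:]"
    using N by (simp add: p_def pderiv_diff pderiv_monom monom_0 zero_power)
  obtain R where R: "size R = Polynomial.degree p" "p = smult (Polynomial.lead_coeff p) (\<Prod>x\<in>#R. [:-x, 1:])"
    using alg_closed_imp_factorization[OF p0] by blast
  \<comment> \<open>A repeated root would also be a root of the derivative.\<close>
  have "count R z \<le> 1" for z
  proof (rule ccontr)
    assume "\<not> count R z \<le> 1"
    then have "z \<in># R" "z \<in># R - {#z#}"
      by (simp_all flip: count_greater_zero_iff)
    then obtain S where S: "R = add_mset z (add_mset z S)"
      by (metis insert_DiffM)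
    then obtain r where r: "p = [:-z, 1:] * ([:-z, 1:] * r)"
      using R(2) by (metis (no_types, lifting) image_mset_add_mset mult_smult_right prod_mset.add_mset)
    have "poly (pderiv p) z = 0"
      by (subst r) (simp only: pderiv_mult, simp)
    then show False
      using a by (simp add: pd)
  qed
  then have "R = mset_set (set_mset R)"
    by (intro multiset_eqI) (auto simp: count_mset_set' le_Suc_eq simp flip: not_in_iff)
  then have "size R = card (set_mset R)"
    by (metis size_mset_set)
  moreover have "set_mset R = frob_eigenspace N a"
  proof -
    have "poly p x = 0 \<longleftrightarrow> x \<in># R" for x
      using p0 by (subst R(2)) (auto simp: poly_prod_mset)
    then show ?thesis
      using roots by auto
  qed
  ultimately show "finite (frob_eigenspace N a)" "card (frob_eigenspace N a) = CARD('a) ^ N"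
    using R(1) deg by (metis finite_set_mset, simp)
qed

text \<open>The usual eigenvector argument: raising the relation to the power q^N multiplies each
  \<open>x i\<close> by \<open>a i\<close>, and subtracting \<open>a k\<close> times the relation
  eliminates \<open>x k\<close>. Induction applies to the rescaled remaining terms.\<close>

lemma frob_eigenspaces_independent:
  fixes a :: "'i \<Rightarrow> 'a::{field,finite}"
  assumes "finite I" "inj_on a I" "\<And>i. i \<in> I \<Longrightarrow> x i \<in> frob_eigenspace N (a i)"
    and "(\<Sum>i\<in>I. x i) = 0" "i \<in> I"
  shows "x i = 0"
  using assms
proof (induction I arbitrary: x i rule: finite_induct)
  case (insert k I)
  have "(\<Sum>i\<in>insert k I. x i) ^ (CARD('a) ^ N) = (\<Sum>i\<in>insert k I. to_ac (a i) * x i)"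
    unfolding power_card_power_sum using insert.prems(2) by (intro sum.cong) (auto simp: frob_eigenspace_def)
  then have "(\<Sum>i\<in>insert k I. to_ac (a i) * x i) = 0"
    using insert.prems(3) zero_less_card_finite[where 'a = 'a] by (simp add: power_0_left)
  moreover have "(\<Sum>i\<in>insert k I. to_ac (a k) * x i) = 0"
    unfolding sum_distrib_left[symmetric] insert.prems(3) by simp
  ultimately have "(\<Sum>i\<in>insert k I. to_ac (a i - a k) * x i) = 0"
    by (simp add: left_diff_distrib sum_subtractf)
  then have "(\<Sum>i\<in>I. to_ac (a i - a k) * x i) = 0"
    using insert.hyps by simp
  then have "to_ac (a i - a k) * x i = 0" if "i \<in> I" for i
    using insert.prems that
    by (intro insert.IH[of "\<lambda>i. to_ac (a i - a k) * x i"] frob_eigenspace_scale) auto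
  then have x: "x i = 0" if "i \<in> I" for i
    using insert.prems(1) insert.hyps that by (metis inj_on_insert imageI mult_eq_0_iff right_minus_eq
        to_ac_eq_0_iff insert_iff inj_on_contraD Diff_insert_absorb)
  then have "x k = 0"
    using insert.prems(3) insert.hyps by simp
  then show ?case
    using x insert.prems(4) by auto
qed simp

lemma card_linearized_roots:
  fixes f :: "nat \<Rightarrow> 'a::{field,finite} alg_closure"
  assumes "k < s" "f k \<noteq> 0"
  shows "finite {x. (\<Sum>k<s. f k * x ^ (CARD('a) ^ k)) = 0}"
    "card {x. (\<Sum>k<s. f k * x ^ (CARD('a) ^ k)) = 0} \<le> CARD('a) ^ (s - 1)"
proof -
  define p where "p = (\<Sum>k<s. Polynomial.monom (f k) (CARD('a) ^ k))"
  have q: "1 < CARD('a)"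
    by (rule one_less_card_field)
  \<comment> \<open>Distinct \<open>k\<close> give distinct exponents q^k, so no coefficients can
    cancel.\<close>
  have "poly.coeff p (CARD('a) ^ k) = (\<Sum>i<s. if i = k then f i else 0)"
    using q by (simp add: p_def coeff_sum)
  then have "p \<noteq> 0"
    using assms by auto
  moreover have "Polynomial.degree p \<le> CARD('a) ^ (s - 1)"
    unfolding p_def using q
    by (intro degree_sum_le) (auto intro!: order.trans[OF degree_monom_le] power_increasing)
  moreover have "poly p x = (\<Sum>k<s. f k * x ^ (CARD('a) ^ k))" for x
    by (simp add: p_def poly_sum poly_monom)
  ultimately show "finite {x. (\<Sum>k<s. f k * x ^ (CARD('a) ^ k)) = 0}"
    "card {x. (\<Sum>k<s. f k * x ^ (CARD('a) ^ k)) = 0} \<le> CARD('a) ^ (s - 1)"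
    using poly_roots_finite[of p] card_poly_roots_bound[of p] by auto
qed

section \<open>Coordinates\<close>

text \<open>Vectors are total functions that vanish outside \<open>S\<close>, so a shorter vector is
  literally also a longer one and message spaces of different lengths are nested.\<close>

definition supported :: "nat set \<Rightarrow> (nat \<Rightarrow> 'a::zero) set" where
  "supported S = {c. \<forall>u. u \<notin> S \<longrightarrow> c u = 0}"

lemma supported_mono: "S \<subseteq> T \<Longrightarrow> supported S \<subseteq> supported T"
  by (auto simp: supported_def)

lemma
  fixes S :: "nat set"
  assumes "finite S"
  shows finite_supported: "finite (supported S :: (nat \<Rightarrow> 'a::{zero,finite}) set)"
    and card_supported: "card (supported S :: (nat \<Rightarrow> 'a) set) = CARD('a) ^ card S"
proof -
  have bij: "bij_betw (\<lambda>c u. if u \<in> S then c u else 0) (S \<rightarrow>\<^sub>E (UNIV :: 'a set)) (supported S)"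
    by (rule bij_betwI[where g = "\<lambda>c. restrict c S"])
      (auto simp: supported_def fun_eq_iff PiE_iff extensional_def)
  have "finite (S \<rightarrow>\<^sub>E (UNIV :: 'a set))"
    using assms by (intro finite_PiE) auto
  then show "finite (supported S :: (nat \<Rightarrow> 'a) set)"
    using bij bij_betw_finite by blast
  show "card (supported S :: (nat \<Rightarrow> 'a) set) = CARD('a) ^ card S"
    using bij_betw_same_card[OF bij] assms by (simp add: card_PiE)
qed

definition comb :: "(nat \<Rightarrow> 'a::field alg_closure) \<Rightarrow> nat \<Rightarrow> (nat \<Rightarrow> 'a) \<Rightarrow> 'a alg_closure" where
  "comb b N c = (\<Sum>u<N. to_ac (c u) * b u)"

lemma comb_zero [simp]: "comb b N (\<lambda>_. 0) = 0"
  by (simp add: comb_def)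

lemma comb_add: "comb b N (\<lambda>u. c u + e u) = comb b N c + comb b N e"
  by (simp add: comb_def algebra_simps sum.distrib)

lemma comb_diff: "comb b N (\<lambda>u. c u - e u) = comb b N c - comb b N e"
  by (simp add: comb_def algebra_simps sum_subtractf)

lemma comb_scale: "comb b N (\<lambda>u. a * c u) = to_ac a * comb b N c"
  by (simp add: comb_def sum_distrib_left mult.assoc)

lemma comb_cut:
  assumes "c \<in> supported {..<n}" "n \<le> N"
  shows "comb b N c = comb b n c"
  unfolding comb_def by (rule sum.mono_neutral_right) (use assms in \<open>auto simp: supported_def\<close>)

text \<open>A maximal independent subset of \<open>E\<close>, enumerated by an initial segment of
  the naturals, is a basis over the base field; the cardinality of \<open>E\<close> fixes its
  size.\<close>

lemma supported_basis_exists: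
  fixes E :: "'a::{field,finite} alg_closure set"
  assumes E0: "0 \<in> E" and add: "\<And>x y. x \<in> E \<Longrightarrow> y \<in> E \<Longrightarrow> x + y \<in> E"
    and scale: "\<And>a x. x \<in> E \<Longrightarrow> to_ac a * x \<in> E"
    and fin: "finite E" and card: "card E = CARD('a) ^ N"
  shows "\<exists>b. bij_betw (comb b N) (supported {..<N}) E"
proof -
  interpret V: vector_space "\<lambda>a x :: 'a alg_closure. to_ac a * x"
    by unfold_locales (auto simp: algebra_simps)
  have sub: "V.subspace E"
    by (intro V.subspaceI) (auto intro: assms)
  obtain B where B: "B \<subseteq> E" "V.independent B" "E \<subseteq> V.span B"
    using V.maximal_independent_subset[of E] by blast
  have finB: "finite B"
    using B(1) fin finite_subset by blast
  have span: "V.span B = E"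
    using B V.span_minimal[OF B(1) sub] by blast
  obtain b where b: "bij_betw b {..<card B} B"
    using finB ex_bij_betw_nat_finite by (metis atLeast0LessThan)
  have comb: "comb b (card B) c = (\<Sum>v\<in>B. to_ac (c (the_inv_into {..<card B} b v)) * v)" for c
  proof -
    have "comb b (card B) c = (\<Sum>u<card B. to_ac (c (the_inv_into {..<card B} b (b u))) * b u)"
      unfolding comb_def using b by (intro sum.cong) (auto simp: bij_betw_def the_inv_into_f_f)
    then show ?thesis
      by (simp add: sum.reindex_bij_betw[OF b, where g = "\<lambda>v. to_ac (c (the_inv_into {..<card B} b v)) * v"])
  qed
  have "bij_betw (comb b (card B)) (supported {..<card B}) E"
  proof (rule bij_betw_imageI)
    show "inj_on (comb b (card B)) (supported {..<card B})"
    proof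
      fix c e :: "nat \<Rightarrow> 'a"
      assume ce: "c \<in> supported {..<card B}" "e \<in> supported {..<card B}"
        and eq: "comb b (card B) c = comb b (card B) e"
      have "(\<Sum>v\<in>B. to_ac (c (the_inv_into {..<card B} b v) - e (the_inv_into {..<card B} b v)) * v) = 0"
        using eq unfolding comb by (simp add: left_diff_distrib sum_subtractf)
      then have *: "c (the_inv_into {..<card B} b v) - e (the_inv_into {..<card B} b v) = 0" if "v \<in> B" for v
        by (rule V.independentD[OF B(2) finB subset_refl _ that])
      have "c u = e u" for u
      proof (cases "u < card B")
        case True
        then show ?thesis
          using *[of "b u"] b by (auto simp: bij_betw_def the_inv_into_f_f)
      qed (use ce in \<open>auto simp: supported_def\<close>)
      then show "c = e" ..
    qed
    show "comb b (card B) ` supported {..<card B} = E"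
    proof (intro equalityI subsetI)
      fix x assume "x \<in> comb b (card B) ` supported {..<card B}"
      then obtain c where "x = (\<Sum>v\<in>B. to_ac (c (the_inv_into {..<card B} b v)) * v)"
        unfolding comb by blast
      then show "x \<in> E"
        using B(1) by (auto intro!: V.subspace_sum[OF sub] scale)
    next
      fix x assume "x \<in> E"
      then obtain g where g: "x = (\<Sum>v\<in>B. to_ac (g v) * v)"
        using span V.span_finite[OF finB] by auto
      define c where "c = (\<lambda>u. if u < card B then g (b u) else 0)"
      have "comb b (card B) c = x"
        unfolding comb g
      proof (intro sum.cong refl)
        fix v assume "v \<in> B"
        then have "the_inv_into {..<card B} b v < card B" "b (the_inv_into {..<card B} b v) = v"
          using b the_inv_into_into[of b "{..<card B}" v "{..<card B}"]
          by (auto simp: bij_betw_def f_the_inv_into_f)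
        then show "to_ac (c (the_inv_into {..<card B} b v)) * v = to_ac (g v) * v"
          by (simp add: c_def)
      qed
      moreover have "c \<in> supported {..<card B}"
        by (auto simp: c_def supported_def)
      ultimately show "x \<in> comb b (card B) ` supported {..<card B}"
        by blast
    qed
  qed
  moreover from this have "CARD('a) ^ card B = CARD('a) ^ N"
    using bij_betw_same_card card card_supported[of "{..<card B}", where 'a = 'a] by fastforce
  then have "card B = N"
    using one_less_card_field[where 'a = 'a] by (simp add: power_inject_exp)
  ultimately show ?thesis
    by blast
qed

lemma frob_eigenspace_basis_exists:
  fixes a :: "'a::{field,finite}"
  assumes "a \<noteq> 0" "0 < N"
  shows "\<exists>b. bij_betw (comb b N) (supported {..<N}) (frob_eigenspace N a)"
  by (intro supported_basis_exists card_frob_eigenspace[OF assms])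
    (auto intro: frob_eigenspace_zero frob_eigenspace_add frob_eigenspace_scale)

section \<open>Rank by counting\<close>

text \<open>Coordinates with respect to a finite basis identify the space with the functions from
  the basis to the field, so dimensions can be read off from cardinalities.\<close>

lemma card_vectorspace:
  fixes V :: "('a::{field,finite}, 'v) module"
  assumes V: "vectorspace class_ring V" and finC: "finite (carrier V)"
  shows "card (carrier V) = CARD('a) ^ vectorspace.dim class_ring V"
proof -
  interpret vectorspace class_ring V
    by (rule V)
  have "gen_set (carrier V)"
    using in_own_span[of "carrier V"] span_is_subset2[of "carrier V"] by auto
  then have "fin_dim"
    unfolding fin_dim_def using finC by (intro exI[of _ "carrier V"]) simp
  then obtain B where B: "finite B" "basis B"
    using finite_basis_exists by blast
  have BV: "B \<subseteq> carrier V"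
    using B by (simp add: basis_def)
  have ex1: "\<exists>!a. a \<in> B \<rightarrow>\<^sub>E (UNIV :: 'a set) \<and> lincomb a B = v" if "v \<in> carrier V" for v
    using basis_criterion[OF B(1) BV] B(2) that by simp
  have "bij_betw (\<lambda>a. lincomb a B) (B \<rightarrow>\<^sub>E (UNIV :: 'a set)) (carrier V)"
  proof (rule bij_betw_imageI)
    have closed: "lincomb a B \<in> carrier V" for a
      using BV by (intro lincomb_closed) auto
    show "inj_on (\<lambda>a. lincomb a B) (B \<rightarrow>\<^sub>E (UNIV :: 'a set))"
      using ex1[OF closed] by (intro inj_onI) metis
    show "(\<lambda>a. lincomb a B) ` (B \<rightarrow>\<^sub>E (UNIV :: 'a set)) = carrier V"
      using closed ex1 by (fastforce simp: image_iff)
  qed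
  then have "card (carrier V) = card (B \<rightarrow>\<^sub>E (UNIV :: 'a set))"
    by (simp add: bij_betw_same_card)
  then show ?thesis
    using B by (simp add: card_PiE dim_basis)
qed

text \<open>Rank-nullity by counting: the image of the matrix is its column space, and each nonempty
  fibre is a translate of the kernel.\<close>

lemma card_mat_kernel:
  fixes A :: "'a::{field,finite} mat"
  assumes A: "A \<in> carrier_mat m n"
    and finC: "finite (carrier_vec n :: 'a vec set)"
  shows "card {v \<in> carrier_vec n. A *\<^sub>v v = 0\<^sub>v m} * CARD('a) ^ vec_space.rank m A
    = card (carrier_vec n :: 'a vec set)"
proof -
  interpret vec_space "TYPE('a)" m .
  let ?K = "{v \<in> carrier_vec n. A *\<^sub>v v = 0\<^sub>v m}"
  let ?I = "(\<lambda>v. A *\<^sub>v v) ` carrier_vec n"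
  have cols: "set (cols A) \<subseteq> carrier_vec m"
    using A cols_dim by blast
  have I: "span (set (cols A)) = ?I"
    using col_space_eq[OF A] A by (auto simp: col_space_def)
  have "finite ?I"
    using finC by simp
  moreover have "vectorspace class_ring (span_vs (set (cols A)))"
    using cols by (intro subspace_is_vs span_is_subspace) (simp add: module_vec_simps)
  ultimately have cardI: "card ?I = CARD('a) ^ rank A"
    using card_vectorspace[of "span_vs (set (cols A))"] I by (simp add: rank_def)
  have fiber: "card {v \<in> carrier_vec n. A *\<^sub>v v = y} = card ?K" if y: "y \<in> ?I" for y
  proof -
    obtain w where w: "w \<in> carrier_vec n" "y = A *\<^sub>v w"
      using y by auto
    have "bij_betw (\<lambda>v. v + w) ?K {v \<in> carrier_vec n. A *\<^sub>v v = y}"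
      by (rule bij_betwI[where g = "\<lambda>v. v - w"])
        (use A w in \<open>auto simp: mult_add_distrib_mat_vec mult_minus_distrib_mat_vec\<close>)
    then show ?thesis
      by (rule bij_betw_same_card[symmetric])
  qed
  have "card (carrier_vec n :: 'a vec set) = card (\<Union>y\<in>?I. {v \<in> carrier_vec n. A *\<^sub>v v = y})"
    by (rule arg_cong[where f = card]) auto
  also have "\<dots> = (\<Sum>y\<in>?I. card {v \<in> carrier_vec n. A *\<^sub>v v = y})"
    using finC by (intro card_UN_disjoint) auto
  also have "\<dots> = card ?I * card ?K"
    by (simp add: fiber)
  finally show ?thesis
    using cardI by simp
qed

lemma bij_betw_supported_vec:
  "bij_betw (\<lambda>c. vec n c) (supported {..<n}) (carrier_vec n)"
  by (rule bij_betwI[where g = "\<lambda>v u. if u < n then vec_index v u else 0"]) (auto simp: supported_def fun_eq_iff)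

lemma card_supported_kernel:
  fixes A :: "'a::{field,finite} mat"
  assumes A: "A \<in> carrier_mat m n"
  shows "card {c \<in> supported {..<n}. \<forall>r<m. (\<Sum>l<n. A $$ (r, l) * c l) = 0} * CARD('a) ^ vec_space.rank m A
    = CARD('a) ^ n"
proof -
  have finC: "finite (carrier_vec k :: 'a vec set)" for k
    by (rule bij_betw_finite[THEN iffD1, OF bij_betw_supported_vec finite_supported]) simp
  have "card (carrier_vec n :: 'a vec set) = CARD('a) ^ n"
    by (simp add: bij_betw_same_card[OF bij_betw_supported_vec, symmetric] card_supported)
  moreover have bij: "bij_betw (\<lambda>c. vec n c) {c \<in> supported {..<n}. \<forall>r<m. (\<Sum>l<n. A $$ (r, l) * c l) = 0}
    {v \<in> carrier_vec n. A *\<^sub>v v = 0\<^sub>v m}"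
  proof -
    have "A *\<^sub>v vec n c = 0\<^sub>v m \<longleftrightarrow> (\<forall>r<m. (\<Sum>l<n. A $$ (r, l) * c l) = 0)" for c
      using A by (auto simp: vec_eq_iff scalar_prod_def atLeast0LessThan)
    then show ?thesis
      by (intro bij_betw_Collect[OF bij_betw_supported_vec]) simp
  qed
  ultimately show ?thesis
    using card_mat_kernel[OF A finC] bij_betw_same_card[OF bij] by simp
qed

section \<open>Matrices whose columns are coordinate vectors\<close>

definition coord :: "(nat \<Rightarrow> 'a::field alg_closure) \<Rightarrow> nat \<Rightarrow> 'a alg_closure \<Rightarrow> nat \<Rightarrow> 'a" where
  "coord b N = the_inv_into (supported {..<N}) (comb b N)"

text \<open>When the values of \<open>y\<close> lie in the span of \<open>b\<close>, the rows from
  \<open>N\<close> up to \<open>m\<close> are zero padding; this allows a field of degree smaller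
  than the number of rows.\<close>

definition coord_mat :: "(nat \<Rightarrow> 'a::field alg_closure) \<Rightarrow> nat \<Rightarrow> nat \<Rightarrow> nat \<Rightarrow> (nat \<Rightarrow> 'a alg_closure) \<Rightarrow> 'a mat" where
  "coord_mat b N m n y = mat m n (\<lambda>(r, l). coord b N (y l) r)"

context
  fixes b :: "nat \<Rightarrow> 'a::{field,finite} alg_closure" and N :: nat and E :: "'a alg_closure set"
  assumes bij: "bij_betw (comb b N) (supported {..<N}) E"
begin

lemma comb_mem: "comb b N c \<in> E"
proof -
  let ?c = "\<lambda>u. if u < N then c u else 0"
  have "comb b N c = comb b N ?c"
    by (simp add: comb_def)
  moreover have "?c \<in> supported {..<N}"
    by (simp add: supported_def)
  ultimately show ?thesis
    using bij by (metis bij_betwE)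
qed

lemma comb_single:
  assumes "u < N"
  shows "comb b N (\<lambda>v. if v = u then 1 else 0) = b u"
proof -
  have "comb b N (\<lambda>v. if v = u then 1 else 0) = (\<Sum>v<N. if v = u then b v else 0)"
    unfolding comb_def by (intro sum.cong) auto
  then show ?thesis
    using assms by simp
qed

lemma basis_mem: "u < N \<Longrightarrow> b u \<in> E"
  using comb_mem comb_single by metis

lemma comb_eq_iff:
  "c \<in> supported {..<N} \<Longrightarrow> e \<in> supported {..<N} \<Longrightarrow> comb b N c = comb b N e \<longleftrightarrow> c = e"
  using bij by (auto simp: bij_betw_def inj_on_def)

lemma comb_eq_0_iff: "c \<in> supported {..<N} \<Longrightarrow> comb b N c = 0 \<longleftrightarrow> c = (\<lambda>_. 0)"
  using comb_eq_iff[of c "\<lambda>_. 0"] by (simp add: supported_def)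

lemma basis_nonzero:
  assumes "u < N"
  shows "b u \<noteq> 0"
proof
  assume "b u = 0"
  then have "comb b N (\<lambda>v. if v = u then 1 else 0) = 0"
    using assms by (simp add: comb_single)
  then have "(\<lambda>v. if v = u then 1 else 0 :: 'a) = (\<lambda>_. 0)"
    using assms by (subst (asm) comb_eq_0_iff) (auto simp: supported_def)
  then show False
    by (metis zero_neq_one)
qed

lemma comb_coord: "x \<in> E \<Longrightarrow> comb b N (coord b N x) = x"
  using bij f_the_inv_into_f[of "comb b N" "supported {..<N}" x]
  by (simp add: coord_def bij_betw_def)

lemma coord_supported: "x \<in> E \<Longrightarrow> coord b N x \<in> supported {..<N}"
  using bij the_inv_into_into[of "comb b N" "supported {..<N}" x "supported {..<N}"]
  by (simp add: coord_def bij_betw_def)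

lemma coord_comb: "c \<in> supported {..<N} \<Longrightarrow> coord b N (comb b N c) = c"
  using bij by (simp add: coord_def bij_betw_def the_inv_into_f_f)

lemma coord_zero: "coord b N 0 = (\<lambda>_. 0)"
  using coord_comb[of "\<lambda>_. 0"] by (simp add: supported_def)

lemma coord_add:
  assumes "x \<in> E" "y \<in> E"
  shows "coord b N (x + y) = (\<lambda>u. coord b N x u + coord b N y u)"
proof -
  let ?c = "\<lambda>u. coord b N x u + coord b N y u"
  have "comb b N ?c = x + y"
    by (simp add: comb_add comb_coord assms)
  moreover have "?c \<in> supported {..<N}"
    using assms[THEN coord_supported] by (simp add: supported_def)
  ultimately show ?thesis
    using coord_comb by metis
qed

lemma coord_scale:
  assumes "x \<in> E"
  shows "coord b N (to_ac a * x) = (\<lambda>u. a * coord b N x u)"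
proof -
  let ?c = "\<lambda>u. a * coord b N x u"
  have "comb b N ?c = to_ac a * x"
    by (simp add: comb_scale comb_coord assms)
  moreover have "?c \<in> supported {..<N}"
    using assms[THEN coord_supported] by (simp add: supported_def)
  ultimately show ?thesis
    using coord_comb by metis
qed

text \<open>Taking coordinates is linear and injective on \<open>E\<close>, so the kernel of the
  matrix consists of the linear relations among the elements \<open>y l\<close>.\<close>

lemma card_kernel_coord_mat:
  assumes y: "\<And>l. l < n \<Longrightarrow> y l \<in> E" and Nm: "N \<le> m"
  shows "card {v \<in> supported {..<n}. comb y n v = 0} * CARD('a) ^ vec_space.rank m (coord_mat b N m n y)
    = CARD('a) ^ n"
proof -
  have "(\<forall>r<m. (\<Sum>l<n. coord_mat b N m n y $$ (r, l) * v l) = 0) \<longleftrightarrow> comb y n v = 0" for v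
  proof -
    \<comment> \<open>\<open>w\<close> is the coordinate vector of the combination of the
      \<open>y l\<close> with coefficients \<open>v\<close>.\<close>
    define w where "w = (\<lambda>r. \<Sum>l<n. coord b N (y l) r * v l)"
    have w: "w \<in> supported {..<N}"
      using y[THEN coord_supported] by (auto simp: w_def supported_def)
    have "(\<forall>r<m. (\<Sum>l<n. coord_mat b N m n y $$ (r, l) * v l) = 0) \<longleftrightarrow> (\<forall>r<m. w r = 0)"
      by (simp add: coord_mat_def w_def)
    also have "\<dots> \<longleftrightarrow> w = (\<lambda>_. 0)"
    proof
      assume *: "\<forall>r<m. w r = 0"
      have "w u = 0" for u
        using * w Nm by (cases "u < N") (auto simp: supported_def)
      then show "w = (\<lambda>_. 0)" ..
    qed simp
    also have "\<dots> \<longleftrightarrow> comb b N w = 0"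
      using comb_eq_0_iff[OF w] by simp
    also have "comb b N w = (\<Sum>u<N. \<Sum>l<n. to_ac (v l) * (to_ac (coord b N (y l) u) * b u))"
      by (simp add: comb_def w_def to_ac_sum sum_distrib_right sum_distrib_left mult_ac)
    also have "\<dots> = (\<Sum>l<n. to_ac (v l) * comb b N (coord b N (y l)))"
      by (subst sum.swap) (simp add: comb_def sum_distrib_left)
    also have "\<dots> = comb y n v"
      unfolding comb_def[of y] by (simp add: comb_coord y)
    finally show ?thesis .
  qed
  moreover have "coord_mat b N m n y \<in> carrier_mat m n"
    by (simp add: coord_mat_def)
  ultimately show ?thesis
    using card_supported_kernel[of "coord_mat b N m n y" m n] by simp
qed

end

section \<open>The nested codes\<close>

text \<open>Messages are vectors of \<open>M * K\<close> symbols. In the blocks \<open>1..h\<close> a message is an element of a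
  large field of degree \<open>N i\<close>, by which the basis \<open>b i\<close> is multiplied. In the blocks after \<open>h\<close> it is a
  linearized polynomial with \<open>K\<close> coefficients in the field of degree \<open>M\<close>, evaluated at \<open>b i\<close>. In both
  cases the values stay in the eigenspace spanned by \<open>b i\<close>, and their coordinates are the columns.\<close>

locale linearized_code =
  fixes t h M K :: nat and m n N :: "nat \<Rightarrow> nat"
    and a :: "nat \<Rightarrow> 'a::{field,finite}"
    and g :: "nat \<Rightarrow> 'a alg_closure" and b :: "nat \<Rightarrow> nat \<Rightarrow> 'a alg_closure"
  assumes h: "1 \<le> h" "h \<le> t" and n1: "0 < n 1"
    and g: "bij_betw (comb g M) (supported {..<M}) (frob_eigenspace M 1)"
    and b: "\<And>i. i \<in> {1..t} \<Longrightarrow> bij_betw (comb (b i) (N i)) (supported {..<N i}) (frob_eigenspace (N i) (a i))"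
    and n_le: "\<And>i. i \<in> {1..t} \<Longrightarrow> n i \<le> N i" and N_le: "\<And>i. i \<in> {1..t} \<Longrightarrow> N i \<le> m i"
    and head: "\<And>i. i \<in> {1..h} \<Longrightarrow> a i = 1" "\<And>i. i \<in> {1..h} \<Longrightarrow> M * K \<le> N i"
    and tail: "\<And>i. i \<in> {h<..t} \<Longrightarrow> N i = M" "inj_on a {h<..t}"
    and a_nonzero: "\<And>i. i \<in> {h<..t} \<Longrightarrow> a i \<noteq> 0"
    and M: "0 < M"
begin

abbreviation "E i \<equiv> frob_eigenspace (N i) (a i)"

text \<open>The \<open>k\<close>-th run of \<open>M\<close> consecutive symbols, read as an element
  of the field of order q^M.\<close>

definition coef :: "(nat \<Rightarrow> 'a) \<Rightarrow> nat \<Rightarrow> 'a alg_closure" where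
  "coef c k = comb g M (\<lambda>r. c (k * M + r))"

definition lin :: "(nat \<Rightarrow> 'a) \<Rightarrow> 'a alg_closure \<Rightarrow> 'a alg_closure" where
  "lin c x = (\<Sum>k<K. coef c k * x ^ (CARD('a) ^ k))"

definition act :: "(nat \<Rightarrow> 'a) \<Rightarrow> nat \<Rightarrow> 'a alg_closure \<Rightarrow> 'a alg_closure" where
  "act c i x = (if i \<le> h then comb (b i) (N i) c * x else lin c x)"

definition enc :: "(nat \<Rightarrow> 'a) \<Rightarrow> nat \<Rightarrow> 'a mat" where
  "enc c = (\<lambda>i\<in>{1..t}. coord_mat (b i) (N i) (m i) (n i) (\<lambda>l. act c i (b i l)))"

lemma act_zero: "act (\<lambda>_. 0) i x = 0"
  by (simp add: act_def lin_def coef_def)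

lemma act_add: "act (\<lambda>u. c u + e u) i x = act c i x + act e i x"
  by (simp add: act_def lin_def coef_def comb_add algebra_simps sum.distrib)

lemma act_diff: "act (\<lambda>u. c u - e u) i x = act c i x - act e i x"
  by (simp add: act_def lin_def coef_def comb_diff algebra_simps sum_subtractf)

lemma act_scale: "act (\<lambda>u. r * c u) i x = to_ac r * act c i x"
  by (simp add: act_def lin_def coef_def comb_scale mult.assoc sum_distrib_left)

text \<open>Linearity over the base field: the powers with exponent q^k are additive and fix the
  base scalars.\<close>

lemma act_comb: "act c i (comb y k v) = comb (\<lambda>l. act c i (y l)) k v"
proof -
  have "lin c (comb y k v) = comb (\<lambda>l. lin c (y l)) k v"
    unfolding lin_def comb_def[of y] comb_def[of "\<lambda>l. \<Sum>k<K. _ k l"]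
    by (simp add: power_card_power_sum power_mult_distrib to_ac_power_card sum_distrib_left mult_ac)
      (rule sum.swap)
  moreover have "x * comb y k v = comb (\<lambda>l. x * y l) k v" for x
    by (simp add: comb_def sum_distrib_left mult_ac)
  ultimately show ?thesis
    by (simp add: act_def)
qed

text \<open>The multipliers, that is, the message in a head block and the coefficients in a tail
  block, have eigenvalue 1, and Frobenius powers preserve the eigenspace.\<close>

lemma act_mem:
  assumes i: "i \<in> {1..t}" and x: "x \<in> E i"
  shows "act c i x \<in> E i"
proof (cases "i \<le> h")
  case True
  then show ?thesis
    using frob_eigenspace_mult[OF comb_mem[OF b[OF i]] x] head(1)[of i] i by (simp add: act_def)
next
  case False
  have "coef c k * x ^ (CARD('a) ^ k) \<in> frob_eigenspace M (1 * a i)" for k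
    unfolding coef_def using x False i tail(1)[of i]
    by (intro frob_eigenspace_mult comb_mem[OF g] frob_eigenspace_power) auto
  then show ?thesis
    using False i tail(1)[of i] by (auto simp: act_def lin_def intro: frob_eigenspace_sum)
qed

lemma act_basis_mem: "i \<in> {1..t} \<Longrightarrow> l < n i \<Longrightarrow> act c i (b i l) \<in> E i"
  using n_le[of i] by (intro act_mem basis_mem[OF b]) auto

definition ker :: "(nat \<Rightarrow> 'a) \<Rightarrow> nat \<Rightarrow> (nat \<Rightarrow> 'a) set" where
  "ker c i = {v \<in> supported {..<n i}. act c i (comb (b i) (n i) v) = 0}"

section \<open>Ranks of the blocks of a codeword\<close>

lemma card_ker:
  assumes "i \<in> {1..t}"
  shows "card (ker c i) * CARD('a) ^ vec_space.rank (m i) (enc c i) = CARD('a) ^ n i"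
  using card_kernel_coord_mat[OF b[OF assms], of "n i" "\<lambda>l. act c i (b i l)" "m i"]
    act_basis_mem[OF assms] N_le[OF assms] assms
  by (simp add: enc_def ker_def act_comb)

lemma comb_basis_eq_iff:
  assumes "i \<in> {1..t}" "v \<in> supported {..<n i}" "w \<in> supported {..<n i}"
  shows "comb (b i) (n i) v = comb (b i) (n i) w \<longleftrightarrow> v = w"
proof -
  have "v \<in> supported {..<N i}" "w \<in> supported {..<N i}"
    using supported_mono[of "{..<n i}" "{..<N i}"] n_le[OF assms(1)] assms by auto
  then show ?thesis
    using comb_cut[of v "n i" "N i"] comb_cut[of w "n i" "N i"] comb_eq_iff[OF b[OF assms(1)]]
      n_le[OF assms(1)] assms by metis
qed

lemma head_supported:
  assumes "i \<in> {1..h}" "c \<in> supported {..<M * K}"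
  shows "c \<in> supported {..<N i}"
  using supported_mono[of "{..<M * K}" "{..<N i}"] head(2)[OF assms(1)] assms(2) by auto

text \<open>As M * K is at most \<open>N i\<close>, a nonzero message is a nonzero field element.
  Multiplication by it is injective, so the kernel is trivial.\<close>

lemma rank_head:
  assumes i: "i \<in> {1..h}" and c: "c \<in> supported {..<M * K}" "c \<noteq> (\<lambda>_. 0)"
  shows "vec_space.rank (m i) (enc c i) = n i"
proof -
  have it: "i \<in> {1..t}"
    using i h by auto
  have "comb (b i) (N i) c \<noteq> 0"
    using comb_eq_0_iff[OF b[OF it] head_supported[OF i c(1)]] c(2) by simp
  moreover have "comb (b i) (n i) v = 0 \<longleftrightarrow> v = (\<lambda>_. 0)" if "v \<in> supported {..<n i}" for v
    using comb_basis_eq_iff[OF it that, of "\<lambda>_. 0"] by (simp add: supported_def)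
  ultimately have "ker c i = {\<lambda>_. 0}"
    using i by (auto simp: ker_def act_def) (simp add: supported_def)
  then show ?thesis
    using card_ker[OF it, of c] one_less_card_field[where 'a = 'a] by (simp add: power_inject_exp)
qed

text \<open>A nonzero symbol at position \<open>u\<close> makes the coefficient with index
  \<open>u div M\<close> nonzero, because \<open>g\<close> is a basis.\<close>

lemma coef_nonzero:
  assumes "c \<in> supported {..<M * s}" "c \<noteq> (\<lambda>_. 0)"
  shows "\<exists>k<s. coef c k \<noteq> 0"
proof -
  obtain u where u: "c u \<noteq> 0"
    using assms(2) by auto
  define k where "k = u div M"
  have "u < M * s"
    using assms(1) u by (auto simp: supported_def)
  then have k: "k < s"
    unfolding k_def by (simp add: less_mult_imp_div_less mult.commute)
  let ?c = "\<lambda>r. if r < M then c (k * M + r) else 0"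
  have "?c (u mod M) \<noteq> 0"
    using u M by (simp add: k_def)
  then have "?c \<noteq> (\<lambda>_. 0)"
    by metis
  then have "comb g M ?c \<noteq> 0"
    by (subst comb_eq_0_iff[OF g]) (auto simp: supported_def)
  then have "coef c k \<noteq> 0"
    by (simp add: coef_def comb_def)
  then show ?thesis
    using k by blast
qed

lemma lin_eq:
  assumes "c \<in> supported {..<M * s}" "s \<le> K"
  shows "lin c x = (\<Sum>k<s. coef c k * x ^ (CARD('a) ^ k))"
proof -
  have "coef c k = 0" if "s \<le> k" for k
  proof -
    have "M * s \<le> k * M + r" for r
      using that by (simp add: mult.commute trans_le_add1)
    then show ?thesis
      using assms(1) by (auto simp: coef_def comb_def supported_def leD intro!: sum.neutral)
  qed
  then show ?thesis
    unfolding lin_def using assms(2) by (intro sum.mono_neutral_right) auto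
qed

lemma finite_ker: "finite (ker c i)"
  using finite_supported[of "{..<n i}"] by (auto simp: ker_def intro: finite_subset)

text \<open>The kernels of the tail blocks embed into the root space of one linearized polynomial, as a
  direct sum because they lie in different eigenspaces of the Frobenius.\<close>

lemma rank_tail:
  assumes c: "c \<in> supported {..<M * s}" "c \<noteq> (\<lambda>_. 0)" and s: "s \<le> K"
  shows "(\<Sum>i\<in>{h<..t}. n i) \<le> (\<Sum>i\<in>{h<..t}. vec_space.rank (m i) (enc c i)) + (s - 1)"
proof -
  let ?I = "{h<..t}"
  let ?R = "{x. (\<Sum>k<s. coef c k * x ^ (CARD('a) ^ k)) = 0}"
  let ?f = "\<lambda>v. \<Sum>i\<in>?I. comb (b i) (n i) (v i)"
  have R: "finite ?R" "card ?R \<le> CARD('a) ^ (s - 1)"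
    using coef_nonzero[OF c] card_linearized_roots[of _ s "coef c"] by blast+
  have it: "i \<in> {1..t}" if "i \<in> ?I" for i
    using that by auto
  have inj: "inj_on ?f (PiE ?I (ker c))"
  proof
    fix v w assume v: "v \<in> PiE ?I (ker c)" and w: "w \<in> PiE ?I (ker c)" and eq: "?f v = ?f w"
    have "v i = w i" if i: "i \<in> ?I" for i
    proof -
      have "comb (b i) (n i) (\<lambda>u. v i u - w i u) = 0"
      proof (rule frob_eigenspaces_independent[where I = ?I and a = a and N = M])
        show "(\<Sum>i\<in>?I. comb (b i) (n i) (\<lambda>u. v i u - w i u)) = 0"
          using eq by (simp add: comb_diff sum_subtractf)
        fix k assume k: "k \<in> ?I"
        have "b k l \<in> frob_eigenspace M (a k)" if "l < n k" for l
          using basis_mem[OF b[OF it[OF k]], of l] n_le[OF it[OF k]] tail(1)[OF k] that by simp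
        then show "comb (b k) (n k) (\<lambda>u. v k u - w k u) \<in> frob_eigenspace M (a k)"
          unfolding comb_def by (intro frob_eigenspace_sum frob_eigenspace_scale) auto
      qed (use i tail(2) in auto)
      then show ?thesis
        using comb_basis_eq_iff[OF it[OF i], of "v i" "w i"] PiE_mem[OF v i] PiE_mem[OF w i]
        by (simp add: comb_diff ker_def)
    qed
    then show "v = w"
      by (rule PiE_ext[OF v w])
  qed
  have "?f ` PiE ?I (ker c) \<subseteq> ?R"
  proof
    fix x assume "x \<in> ?f ` PiE ?I (ker c)"
    then obtain v where v: "v \<in> PiE ?I (ker c)" "x = ?f v"
      by blast
    \<comment> \<open>The polynomial is the same for all tail blocks, so by additivity its value at
      the sum is the sum of its values on the blocks.\<close>
    have "lin c x = (\<Sum>k<K. \<Sum>i\<in>?I. coef c k * comb (b i) (n i) (v i) ^ (CARD('a) ^ k))"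
      by (simp add: v(2) lin_def power_card_power_sum sum_distrib_left)
    also have "\<dots> = (\<Sum>i\<in>?I. lin c (comb (b i) (n i) (v i)))"
      unfolding lin_def by (rule sum.swap)
    also have "\<dots> = 0"
      using PiE_mem[OF v(1)] by (intro sum.neutral) (auto simp: ker_def act_def)
    finally show "x \<in> ?R"
      by (simp add: lin_eq[OF c(1) s])
  qed
  then have "card (PiE ?I (ker c)) \<le> card ?R"
    using inj R(1) card_inj_on_le by blast
  then have "(\<Prod>i\<in>?I. card (ker c i)) \<le> CARD('a) ^ (s - 1)"
    using R(2) by (simp add: card_PiE)
  \<comment> \<open>By \<open>card_ker\<close>, the factor q^rank turns each kernel size into q^(n
    i); the claim follows by comparing exponents.\<close>
  then have "(\<Prod>i\<in>?I. card (ker c i)) * CARD('a) ^ (\<Sum>i\<in>?I. vec_space.rank (m i) (enc c i))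
    \<le> CARD('a) ^ (s - 1) * CARD('a) ^ (\<Sum>i\<in>?I. vec_space.rank (m i) (enc c i))"
    by (rule mult_right_mono) simp
  moreover have "(\<Prod>i\<in>?I. card (ker c i)) * CARD('a) ^ (\<Sum>i\<in>?I. vec_space.rank (m i) (enc c i))
    = (\<Prod>i\<in>?I. CARD('a) ^ n i)"
    unfolding power_sum prod.distrib[symmetric] by (intro prod.cong card_ker it) auto
  ultimately have "(\<Prod>i\<in>?I. CARD('a) ^ n i)
    \<le> CARD('a) ^ (s - 1) * CARD('a) ^ (\<Sum>i\<in>?I. vec_space.rank (m i) (enc c i))"
    by linarith
  then have "CARD('a) ^ (\<Sum>i\<in>?I. n i) \<le> CARD('a) ^ ((s - 1) + (\<Sum>i\<in>?I. vec_space.rank (m i) (enc c i)))"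
    by (simp only: power_sum power_add)
  then show ?thesis
    using power_le_imp_le_exp[OF one_less_card_field] by fastforce
qed

text \<open>Head blocks have full rank, so the whole rank defect comes from the tail and is at most
  s - 1.\<close>

lemma srk_ge:
  assumes "c \<in> supported {..<M * s}" "c \<noteq> (\<lambda>_. 0)" "s \<le> K"
  shows "(\<Sum>i=1..t. n i) \<le> srk t m (enc c) + (s - 1)"
proof -
  have "c \<in> supported {..<M * K}"
    using supported_mono[of "{..<M * s}" "{..<M * K}"] assms by auto
  then have head: "(\<Sum>i=1..h. vec_space.rank (m i) (enc c i)) = (\<Sum>i=1..h. n i)"
    using rank_head assms(2) by (intro sum.cong) auto
  have split: "(\<Sum>i=1..t. f i) = (\<Sum>i=1..h. f i) + (\<Sum>i\<in>{h<..t}. f i)" for f :: "nat \<Rightarrow> nat"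
    using h by (subst sum.union_disjoint[symmetric]) (auto intro!: sum.cong)
  show ?thesis
    using rank_tail[OF assms] unfolding srk_def split head by linarith
qed

text \<open>Columns with index in \<open>Z\<close> vanish, so every vector supported on
  \<open>Z\<close> lies in the kernel, which therefore has at least q^(card Z) elements.\<close>

lemma rank_tail_le:
  assumes i: "i \<in> {1..t}" and Z: "Z \<subseteq> {..<n i}" "\<And>l. l \<in> Z \<Longrightarrow> act c i (b i l) = 0"
  shows "vec_space.rank (m i) (enc c i) + card Z \<le> n i"
proof -
  have "supported Z \<subseteq> ker c i"
  proof
    fix v :: "nat \<Rightarrow> 'a" assume v: "v \<in> supported Z"
    have "act c i (comb (b i) (n i) v) = (\<Sum>l<n i. to_ac (v l) * act c i (b i l))"
      by (simp add: act_comb) (simp add: comb_def)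
    also have "\<dots> = 0"
      using v Z(2) by (intro sum.neutral) (auto simp: supported_def)
    finally show "v \<in> ker c i"
      using v supported_mono[OF Z(1)] by (auto simp: ker_def)
  qed
  then have "CARD('a) ^ card Z \<le> card (ker c i)"
    using card_mono[OF finite_ker, of "supported Z"] Z(1) finite_subset[OF Z(1)]
    by (simp add: card_supported)
  then have "CARD('a) ^ (card Z + vec_space.rank (m i) (enc c i)) \<le> CARD('a) ^ n i"
    unfolding power_add card_ker[OF i, of c, symmetric] by (rule mult_right_mono) simp
  then show ?thesis
    using power_le_imp_le_exp[OF one_less_card_field] by (simp add: add.commute)
qed

text \<open>A message of \<open>M * s\<close> symbols whose codeword vanishes in \<open>s - 1\<close> prescribed columns exists
  by the pigeonhole principle, since each column carries only \<open>M\<close> symbols.\<close>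

lemma srk_le_exists:
  assumes s: "1 \<le> s" "s - 1 \<le> (\<Sum>i\<in>{h<..t}. n i)"
  shows "\<exists>c\<in>supported {..<M * s}. c \<noteq> (\<lambda>_. 0) \<and> srk t m (enc c) + (s - 1) \<le> (\<Sum>i=1..t. n i)"
proof -
  let ?I = "{h<..t}"
  have "card (SIGMA i:?I. {..<n i}) = (\<Sum>i\<in>?I. n i)"
    by (simp add: card_SigmaI)
  \<comment> \<open>The columns are taken from tail blocks only, where each value ranges over just
    q^M elements.\<close>
  then obtain Z where Z: "Z \<subseteq> (SIGMA i:?I. {..<n i})" "card Z = s - 1" "finite Z"
    using s(2) obtain_subset_with_card_n by metis
  let ?T = "\<Pi>\<^sub>E z\<in>Z. frob_eigenspace M (a (fst z))"
  let ?f = "\<lambda>c. \<lambda>z\<in>Z. act c (fst z) (b (fst z) (snd z))"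
  have "card ?T = (\<Prod>z\<in>Z. card (frob_eigenspace M (a (fst z))))"
    by (rule card_PiE[OF Z(3)])
  also have "\<dots> = (\<Prod>z\<in>Z. CARD('a) ^ M)"
    using Z(1) by (intro prod.cong refl card_frob_eigenspace a_nonzero M) auto
  finally have "card ?T = (\<Prod>z\<in>Z. CARD('a) ^ M)" .
  then have cardT: "card ?T = CARD('a) ^ (M * (s - 1))"
    using Z(2) by (simp add: power_mult)
  have finT: "finite ?T"
    using Z a_nonzero M by (intro finite_PiE card_frob_eigenspace) auto
  have "?f ` supported {..<M * s} \<subseteq> ?T"
  proof
    fix x assume "x \<in> ?f ` supported {..<M * s}"
    then obtain c where x: "x = ?f c"
      by blast
    have "act c (fst z) (b (fst z) (snd z)) \<in> frob_eigenspace M (a (fst z))" if "z \<in> Z" for z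
    proof -
      have "fst z \<in> ?I" "snd z < n (fst z)"
        using that Z(1) by auto
      then show ?thesis
        using act_basis_mem[of "fst z" "snd z" c] tail(1)[of "fst z"] by auto
    qed
    then show "x \<in> ?T"
      by (auto simp: x)
  qed
  then have "card (?f ` supported {..<M * s}) \<le> CARD('a) ^ (M * (s - 1))"
    unfolding cardT[symmetric] by (rule card_mono[OF finT])
  also have "\<dots> < CARD('a) ^ (M * s)"
    using s(1) M one_less_card_field[where 'a = 'a] by (intro power_strict_increasing) auto
  also have "\<dots> = card (supported {..<M * s} :: (nat \<Rightarrow> 'a) set)"
    by (simp add: card_supported)
  finally have "\<not> inj_on ?f (supported {..<M * s})"
    by (rule pigeonhole)
  then obtain c e where ce: "c \<in> supported {..<M * s}" "e \<in> supported {..<M * s}" "?f c = ?f e" "c \<noteq> e"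
    unfolding inj_on_def by blast
  \<comment> \<open>Two colliding messages agree on all chosen columns, so by linearity their
    difference vanishes there.\<close>
  define w where "w = (\<lambda>u. c u - e u)"
  have w: "w \<in> supported {..<M * s}" "w \<noteq> (\<lambda>_. 0)"
    using ce by (auto simp: w_def supported_def fun_eq_iff)
  have zero: "act w (fst z) (b (fst z) (snd z)) = 0" if "z \<in> Z" for z
    using fun_cong[OF ce(3), of z] that by (simp add: w_def act_diff)
  let ?Z = "\<lambda>i. {l. (i, l) \<in> Z}"
  \<comment> \<open>For head blocks \<open>?Z i\<close> is empty, and this merely bounds the rank by
    the number of columns.\<close>
  have le: "vec_space.rank (m i) (enc w i) + card (?Z i) \<le> n i" if "i \<in> {1..t}" for i
    using that Z(1) zero by (intro rank_tail_le) force+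
  have finZ: "finite (?Z i)" for i
    by (rule finite_subset[OF _ finite_imageI[OF Z(3), of snd]]) force
  have "Z = (SIGMA i:{1..t}. ?Z i)"
    using Z(1) by auto
  then have "card Z = card (SIGMA i:{1..t}. ?Z i)"
    by (rule arg_cong)
  also have "\<dots> = (\<Sum>i=1..t. card (?Z i))"
    using finZ by (intro card_SigmaI) auto
  finally have cardZ: "card Z = (\<Sum>i=1..t. card (?Z i))" .
  have "srk t m (enc w) + (s - 1) = (\<Sum>i=1..t. vec_space.rank (m i) (enc w i) + card (?Z i))"
    unfolding srk_def Z(2)[symmetric] cardZ by (rule sum.distrib[symmetric])
  also have "\<dots> \<le> (\<Sum>i=1..t. n i)"
    by (intro sum_mono le)
  finally have "srk t m (enc w) + (s - 1) \<le> (\<Sum>i=1..t. n i)" .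
  then show ?thesis
    using w by blast
qed

section \<open>Linearity, dimension and distance of the codes\<close>

lemma enc_zero: "enc (\<lambda>_. 0) = \<zero>\<^bsub>sumrank_space TYPE('a) t m n\<^esub>"
  by (auto simp: enc_def sumrank_space_simps fun_eq_iff coord_mat_def act_zero coord_zero[OF b])

lemma enc_add: "enc (\<lambda>u. c u + e u) = enc c \<oplus>\<^bsub>sumrank_space TYPE('a) t m n\<^esub> enc e"
  by (auto simp: enc_def sumrank_space_simps fun_eq_iff coord_mat_def act_add
      coord_add[OF b act_basis_mem act_basis_mem])

lemma enc_scale: "enc (\<lambda>u. r * c u) = r \<odot>\<^bsub>sumrank_space TYPE('a) t m n\<^esub> enc c"
  by (auto simp: enc_def sumrank_space_simps fun_eq_iff coord_mat_def act_scale
      coord_scale[OF b act_basis_mem])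

lemma enc_carrier: "enc c \<in> carrier (sumrank_space TYPE('a) t m n)"
  by (auto simp: enc_def sumrank_space_simps coord_mat_def)

text \<open>The first column of block 1 already determines the message: it holds the coordinates of
  the message, as a field element, times the nonzero element \<open>b 1 0\<close>.\<close>

lemma inj_enc: "inj_on enc (supported {..<M * K})"
proof
  fix c e assume ce: "c \<in> supported {..<M * K}" "e \<in> supported {..<M * K}" and eq: "enc c = enc e"
  have one: "1 \<in> {1..t}" "1 \<in> {1..h}"
    using h by auto
  have N1: "0 < N 1"
    using n1 n_le[OF one(1)] by simp
  let ?x = "act c 1 (b 1 0)" and ?y = "act e 1 (b 1 0)"
  have xy: "?x \<in> E 1" "?y \<in> E 1"
    using act_basis_mem[OF one(1) n1] by auto
  have "coord (b 1) (N 1) ?x r = coord (b 1) (N 1) ?y r" for r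
  proof (cases "r < m 1")
    case True
    then show ?thesis
      using arg_cong[OF fun_cong[OF eq, of 1], of "\<lambda>A. A $$ (r, 0)"] one n1
      by (simp add: enc_def coord_mat_def)
  next
    case False
    then show ?thesis
      using N_le[OF one(1)] xy[THEN coord_supported[OF b[OF one(1)]]] by (simp add: supported_def)
  qed
  then have "?x = ?y"
    using comb_coord[OF b[OF one(1)]] xy by (metis ext)
  then have "comb (b 1) (N 1) c = comb (b 1) (N 1) e"
    using basis_nonzero[OF b[OF one(1)] N1] h by (simp add: act_def)
  then show "c = e"
    using comb_eq_iff[OF b[OF one(1)]] head_supported[OF one(2)] ce by blast
qed

definition subcode :: "nat \<Rightarrow> (nat \<Rightarrow> 'a mat) set" where
  "subcode s = enc ` supported {..<M * s}"

lemma subcode_mono: "s \<le> s' \<Longrightarrow> subcode s \<subseteq> subcode s'"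
  unfolding subcode_def by (intro image_mono supported_mono) auto

lemma code_subcode: "code t m n (subcode s)"
proof -
  let ?V = "sumrank_space TYPE('a) t m n"
  have "vectorspace class_ring ?V"
    by (rule vectorspace_sumrank_space)
  moreover have "submodule class_ring (subcode s) ?V"
  proof (rule submodule.intro)
    show "Module.module class_ring ?V"
      using vectorspace_sumrank_space[of t m n, where 'a = 'a] by (simp add: vectorspace_def)
    show "subcode s \<subseteq> carrier ?V"
      using enc_carrier by (auto simp: subcode_def)
    show "\<zero>\<^bsub>?V\<^esub> \<in> subcode s"
      by (auto simp: subcode_def supported_def simp flip: enc_zero)
    show "x \<oplus>\<^bsub>?V\<^esub> y \<in> subcode s" if "x \<in> subcode s" "y \<in> subcode s" for x y
      using that by (auto simp: subcode_def supported_def simp flip: enc_add)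
    show "r \<odot>\<^bsub>?V\<^esub> x \<in> subcode s" if "x \<in> subcode s" for r x
      using that by (auto simp: subcode_def supported_def simp flip: enc_scale)
  qed
  ultimately show ?thesis
    by (simp add: code_def VectorSpace.subspace_def)
qed

text \<open>Injectivity of \<open>enc\<close> gives the code q^(M * s) elements, and
  \<open>card_vectorspace\<close> turns this into the dimension.\<close>

lemma dim_subcode:
  assumes "s \<le> K"
  shows "code_dim t m n (subcode s) = M * s"
proof -
  let ?V = "sumrank_space TYPE('a) t m n"
  have "vectorspace class_ring (?V\<lparr>carrier := subcode s\<rparr>)"
    by (rule vectorspace.subspace_is_vs[OF vectorspace_sumrank_space code_subcode[unfolded code_def]])
  moreover have "finite (subcode s)"
    by (simp add: subcode_def finite_supported)
  moreover have "card (subcode s) = CARD('a) ^ (M * s)"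
    unfolding subcode_def using inj_on_subset[OF inj_enc supported_mono[of "{..<M * s}"]] assms
    by (subst card_image) (auto simp: card_supported)
  ultimately have "CARD('a) ^ (M * s) = CARD('a) ^ code_dim t m n (subcode s)"
    using card_vectorspace[of "?V\<lparr>carrier := subcode s\<rparr>"] by (simp add: code_dim_def)
  then show ?thesis
    using one_less_card_field[where 'a = 'a] by (simp add: power_inject_exp)
qed

text \<open>The lower bound \<open>srk_ge\<close> is attained by the codeword from
  \<open>srk_le_exists\<close>, which is nonzero because \<open>enc\<close> is injective.\<close>

lemma min_distance_subcode:
  assumes s: "1 \<le> s" "s \<le> K" "s - 1 \<le> (\<Sum>i\<in>{h<..t}. n i)"
  shows "min_distance t m n (subcode s) = (\<Sum>i=1..t. n i) - (s - 1)"
proof -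
  let ?S = "srk t m ` (subcode s - {\<zero>\<^bsub>sumrank_space TYPE('a) t m n\<^esub>})"
  obtain c where c: "c \<in> supported {..<M * s}" "c \<noteq> (\<lambda>_. 0)" "srk t m (enc c) + (s - 1) \<le> (\<Sum>i=1..t. n i)"
    using srk_le_exists[OF s(1,3)] by blast
  have "enc c \<noteq> enc (\<lambda>_. 0)"
  proof
    assume "enc c = enc (\<lambda>_. 0)"
    moreover have "c \<in> supported {..<M * K}" "(\<lambda>_. 0) \<in> supported {..<M * K}"
      using supported_mono[of "{..<M * s}" "{..<M * K}"] c(1) s(2) by (auto simp: supported_def)
    ultimately show False
      using inj_onD[OF inj_enc] c(2) by blast
  qed
  moreover have "srk t m (enc c) = (\<Sum>i=1..t. n i) - (s - 1)"
    using srk_ge[OF c(1,2) s(2)] c(3) by simp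
  ultimately have "(\<Sum>i=1..t. n i) - (s - 1) \<in> ?S"
    using c(1) by (auto simp: subcode_def enc_zero image_iff intro!: bexI[of _ "enc c"])
  moreover have "finite ?S"
    by (simp add: subcode_def finite_supported)
  moreover have "(\<Sum>i=1..t. n i) - (s - 1) \<le> x" if x: "x \<in> ?S" for x
  proof -
    obtain e where e: "e \<in> supported {..<M * s}" "x = srk t m (enc e)" "enc e \<noteq> enc (\<lambda>_. 0)"
      using x unfolding subcode_def enc_zero by blast
    then show ?thesis
      using srk_ge[OF e(1) _ s(2)] by fastforce
  qed
  ultimately show ?thesis
    unfolding min_distance_def by (intro Min_eqI) auto
qed

end

section \<open>MSRD parameters\<close>

text \<open>Supplies the parameters \<open>l\<close> and \<epsilon> of the MSRD condition for a
  given distance x + 1.\<close>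

lemma partial_sum_decomposition:
  fixes n :: "nat \<Rightarrow> nat"
  assumes "x < (\<Sum>i=1..t. n i)"
  shows "\<exists>l\<in>{1..t}. \<exists>e<n l. x = (\<Sum>i=1..<l. n i) + e"
  using assms
proof (induction t)
  case (Suc t)
  show ?case
  proof (cases "x < (\<Sum>i=1..t. n i)")
    case True
    then obtain l e where "l \<in> {1..t}" "e < n l" "x = (\<Sum>i=1..<l. n i) + e"
      using Suc.IH by blast
    then show ?thesis
      by (intro bexI[of _ l] exI[of _ e]) auto
  next
    case False
    have "(\<Sum>i=1..<Suc t. n i) = (\<Sum>i=1..t. n i)"
      by (simp add: atLeastLessThanSuc_atLeastAtMost)
    then show ?thesis
      using False Suc.prems
      by (intro bexI[of _ "Suc t"] exI[of _ "x - (\<Sum>i=1..t. n i)"]) auto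
  qed
qed simp

text \<open>From block \<open>j\<close> on all row counts equal \<open>M\<close>, so the required
  dimension is \<open>M\<close> times the number of columns left after the first distance - 1
  columns, namely M * s.\<close>

lemma msrdI:
  fixes C :: "(nat \<Rightarrow> 'a::{field,finite} mat) set"
  assumes pos: "\<And>i. i \<in> {1..t} \<Longrightarrow> n i > 0" and j: "j \<in> {1..t}" and const: "\<And>i. i \<in> {j..t} \<Longrightarrow> m i = M"
    and C: "code t m n C" "min_distance t m n C + (s - 1) = (\<Sum>i=1..t. n i)" "code_dim t m n C = M * s"
    and s: "1 \<le> s" "s \<le> (\<Sum>i=j..t. n i)"
  shows "msrd t m n C"
proof -
  have split: "(\<Sum>i=1..t. n i) = (\<Sum>i=1..<l. n i) + (\<Sum>i=l..t. n i)" if "l \<in> {1..t}" for l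
  proof -
    have "{1..t} = {1..<l} \<union> {l..t}" "{1..<l} \<inter> {l..t} = {}"
      using that by auto
    then show ?thesis
      by (simp only: sum.union_disjoint finite_atLeastAtMost finite_atLeastLessThan)
  qed
  \<comment> \<open>This is the minimum distance minus 1, the quantity to be split into full blocks
    and an offset.\<close>
  define x where "x = (\<Sum>i=1..t. n i) - s"
  have x: "x + s = (\<Sum>i=1..t. n i)"
    using s(2) split[OF j] by (simp add: x_def)
  obtain l e where l: "l \<in> {1..t}" "e < n l" "x = (\<Sum>i=1..<l. n i) + e"
    using partial_sum_decomposition[of x n t] x s(1) by auto
  \<comment> \<open>Otherwise \<open>x\<close> would be smaller than the number of columns before
    block \<open>j\<close>, forcing \<open>s\<close> above the number of remaining columns.\<close>
  have "j \<le> l"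
  proof (rule ccontr)
    assume "\<not> j \<le> l"
    then have "(\<Sum>i=1..<Suc l. n i) \<le> (\<Sum>i=1..<j. n i)"
      by (intro sum_mono2) auto
    then show False
      using l x s(2) split[OF j] by simp
  qed
  have "(\<Sum>i=l..t. m i * n i) = (\<Sum>i=l..t. M * n i)"
    using const \<open>j \<le> l\<close> by (intro sum.cong) auto
  then have "(\<Sum>i=l..t. m i * n i) - e * m l = M * ((\<Sum>i=l..t. n i) - e)"
    using const[of l] \<open>j \<le> l\<close> l(1) by (simp add: diff_mult_distrib2 mult.commute flip: sum_distrib_left)
  also have "(\<Sum>i=l..t. n i) - e = s"
    using x split[OF l(1)] l(3) by simp
  finally have "code_dim t m n C = (\<Sum>i=l..t. m i * n i) - e * m l"
    using C(3) by simp
  moreover have "min_distance t m n C = (\<Sum>i=1..<l. n i) + e + 1"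
    using C(2) x l(3) s(1) by simp
  moreover have "e \<le> n l - 1"
    using l(2) by simp
  ultimately show ?thesis
    unfolding msrd_def using C(1) l(1) by blast
qed

theorem proposition4p17:
  fixes t q j d \<delta> h :: nat and m n :: "nat \<Rightarrow> nat"
  assumes q: "q = CARD('a::{field,finite})"
    and t: "t \<ge> 1"
    and pos: "\<And>i. i \<in> {1..t} \<Longrightarrow> n i > 0"
    and m_ge_n: "\<And>i. i \<in> {1..t} \<Longrightarrow> m i \<ge> n i"
    and m_decr: "\<And>i k. 1 \<le> i \<Longrightarrow> i \<le> k \<Longrightarrow> k \<le> t \<Longrightarrow> m i \<ge> m k"
    and j: "j = Min {i \<in> {1..t}. m i = m t}"
    and \<delta>: "\<delta> \<le> n j - 1"
    and d: "d = (\<Sum>i=1..<j. n i) + \<delta> + 1"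
    and h_ex: "{i \<in> {1..t}. n i > m t} \<noteq> {}"
    and h: "h = Max {i \<in> {1..t}. n i > m t}"
    and m_h: "m h \<ge> m t * ((\<Sum>i=j..t. n i) - \<delta>)"
    and q_gt: "q > t - h"
  shows "\<exists>\<C> :: nat \<Rightarrow> (nat \<Rightarrow> 'a mat) set.
    (\<forall>i\<in>{d..\<Sum>k=1..t. n k}. msrd t m n (\<C> i) \<and> min_distance t m n (\<C> i) = i) \<and>
    (\<forall>i\<in>{d..<\<Sum>k=1..t. n k}. \<C> (i + 1) \<subseteq> \<C> i)"
proof -
  define M where "M = m t"
  \<comment> \<open>This equals n - d + 1, so the largest code, of distance \<open>d\<close>, has
    dimension M * K.\<close>
  define K where "K = (\<Sum>i=j..t. n i) - \<delta>"
  have "h \<in> {i \<in> {1..t}. n i > m t}"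
    unfolding h using h_ex by (intro Max_in) auto
  then have h_mem: "h \<in> {1..t}" and nh: "n h > M"
    by (auto simp: M_def)
  have n_tail: "n i \<le> M" if "i \<in> {h<..t}" for i
  proof (rule ccontr)
    assume "\<not> n i \<le> M"
    then have "i \<le> h"
      unfolding h using that by (intro Max_ge) (auto simp: M_def)
    then show False
      using that by simp
  qed
  have "j \<in> {i \<in> {1..t}. m i = m t}"
    unfolding j using t by (intro Min_in) auto
  then have j_mem: "j \<in> {1..t}" and mj: "m j = M"
    by (auto simp: M_def)
  have m_tail: "m i = M" if "i \<in> {j..t}" for i
    using m_decr[of i t] m_decr[of j i] that j_mem mj by (auto simp: M_def)
  \<comment> \<open>Block \<open>h\<close> has at least n h > M rows, whereas blocks from
    \<open>j\<close> on have exactly \<open>M\<close>.\<close>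
  have "h < j"
  proof (rule ccontr)
    assume "\<not> h < j"
    then have "m h \<le> M"
      using m_decr[of j h] h_mem j_mem mj by auto
    then show False
      using m_ge_n[OF h_mem] nh by simp
  qed
  have m_ge_M: "M \<le> m i" if "i \<in> {1..t}" for i
    using m_decr[of i t] that by (simp add: M_def)
  have M: "0 < M"
    using pos[of t] m_ge_n[of t] t by (simp add: M_def)
  \<comment> \<open>Head blocks use all their rows; tail blocks share the degree \<open>M\<close>,
    with zero padding where m i > M.\<close>
  define N where "N = (\<lambda>i. if i \<le> h then m i else M)"
  \<comment> \<open>The bound on q provides a different nonzero eigenvalue for each of the t - h
    tail blocks.\<close>
  have "card {h<..t} \<le> card (UNIV - {0 :: 'a})"
    using q q_gt by simp
  then obtain a0 :: "nat \<Rightarrow> 'a" where a0: "a0 ` {h<..t} \<subseteq> UNIV - {0}" "inj_on a0 {h<..t}"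
    using card_le_inj[of "{h<..t}" "UNIV - {0 :: 'a}"] by auto
  \<comment> \<open>Eigenvalue 1 makes the head eigenspaces fields, whose elements can serve as
    multipliers.\<close>
  define a where "a = (\<lambda>i. if i \<le> h then 1 else a0 i)"
  have a: "a i \<noteq> 0" if "i \<in> {1..t}" for i
    using a0(1) that by (auto simp: a_def image_subset_iff)
  have inj_a: "inj_on a {h<..t}"
    using a0(2) by (auto simp: a_def inj_on_def)
  have N: "0 < N i" if "i \<in> {1..t}" for i
    using m_ge_M[OF that] M by (simp add: N_def)
  obtain g :: "nat \<Rightarrow> 'a alg_closure" where
    g: "bij_betw (comb g M) (supported {..<M}) (frob_eigenspace M 1)"
    using frob_eigenspace_basis_exists[of "1 :: 'a" M] M by auto
  have "\<exists>b. \<forall>i\<in>{1..t}. bij_betw (comb (b i) (N i)) (supported {..<N i}) (frob_eigenspace (N i) (a i))"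
    by (intro bchoice ballI frob_eigenspace_basis_exists a N)
  then obtain b where b: "\<And>i. i \<in> {1..t} \<Longrightarrow>
      bij_betw (comb (b i) (N i)) (supported {..<N i}) (frob_eigenspace (N i) (a i))"
    by blast
  interpret linearized_code t h M K m n N a g b
  proof
    \<comment> \<open>The hypothesis on \<open>m h\<close> carries over to the earlier blocks
      because \<open>m\<close> is decreasing.\<close>
    show "M * K \<le> N i" if "i \<in> {1..h}" for i
      using m_h m_decr[of i h] h_mem that by (auto simp: N_def M_def K_def)
    show "n i \<le> N i" if "i \<in> {1..t}" for i
      using m_ge_n[OF that] n_tail[of i] that by (auto simp: N_def)
    show "N i \<le> m i" if "i \<in> {1..t}" for i
      using m_ge_M[OF that] by (simp add: N_def)
    show "a i \<noteq> 0" if "i \<in> {h<..t}" for i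
      using a[of i] that by simp
  qed (use h_mem pos[of 1] t M g b inj_a in \<open>auto simp: N_def a_def\<close>)
  have "{1..t} = {1..<j} \<union> {j..t}" "{1..<j} \<inter> {j..t} = {}"
    using j_mem by auto
  then have split: "(\<Sum>i=1..t. n i) = (\<Sum>i=1..<j. n i) + (\<Sum>i=j..t. n i)"
    by (simp only: sum.union_disjoint finite_atLeastAtMost finite_atLeastLessThan)
  have tail_le: "(\<Sum>i=j..t. n i) \<le> (\<Sum>i\<in>{h<..t}. n i)"
    using \<open>h < j\<close> by (intro sum_mono2) auto
  show ?thesis
  \<comment> \<open>Distance \<open>i\<close> corresponds to s = n + 1 - i coefficients, so
    \<open>s\<close> runs from 1 at i = n to \<open>K\<close> at i = d.\<close>
  proof (intro exI[of _ "\<lambda>i. subcode ((\<Sum>k=1..t. n k) + 1 - i)"] conjI ballI)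
    fix i assume i: "i \<in> {d..\<Sum>k=1..t. n k}"
    define s where "s = (\<Sum>k=1..t. n k) + 1 - i"
    have s: "1 \<le> s" "s \<le> K"
      using i d split by (auto simp: s_def K_def)
    then have "s - 1 \<le> (\<Sum>i\<in>{h<..t}. n i)"
      using tail_le by (simp add: K_def)
    then have dist: "min_distance t m n (subcode s) = i"
      using min_distance_subcode[OF s] i by (simp add: s_def)
    then show "min_distance t m n (subcode ((\<Sum>k=1..t. n k) + 1 - i)) = i"
      by (simp only: s_def)
    have "msrd t m n (subcode s)"
    proof (rule msrdI[where M = M and s = s])
      show "min_distance t m n (subcode s) + (s - 1) = (\<Sum>i=1..t. n i)"
        using dist i by (simp add: s_def)
      show "s \<le> (\<Sum>i=j..t. n i)"
        using s(2) by (simp add: K_def)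
    qed (use pos j_mem m_tail code_subcode dim_subcode[OF s(2)] s(1) in auto)
    then show "msrd t m n (subcode ((\<Sum>k=1..t. n k) + 1 - i))"
      by (simp only: s_def)
  next
    fix i
    show "subcode ((\<Sum>k=1..t. n k) + 1 - (i + 1)) \<subseteq> subcode ((\<Sum>k=1..t. n k) + 1 - i)"
      by (rule subcode_mono) simp
  qed
qed

end
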